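(* Let $(G=(V,E,w),\sigma)$ be a connected connection graph, with $\sigma$ taking values in $\mathbb{O}(d)$, and let $\alpha,\beta\in\ell(V;\mathbb{R}^d)$. Then strong duality holds for the Beckmann problem on $(G,\sigma)$, in the sense that $$\mathcal{W}_1^\sigma(\alpha,\beta)=\inf_{J\in\ell(E';\mathbb{R}^d)}\left\{\sum_{e\in E'}w(e)\|J(e)\|_2 : BJ=\alpha-\beta\right\}=\sup_{\phi\in\ell(V;\mathbb{R}^d)}\left\{\langle\phi,\alpha-\beta\rangle : \|(B^\top\phi)(e)\|_2\le w(e)\text{ for all }e\in E'\right\},$$ as an equality in $[0,+\infty]$.
   Context: $G=(V,E,w)$ is a finite, connected, weighted, undirected graph with $V=\{1,\dots,n\}$, $n\ge 2$, $E\subseteq\binom{V}{2}$, $|E|=m\ge1$, and symmetric weights $w_{ij}\ge 0$ with $w_{ij}>0$ iff $\{i,j\}\in E$ (written $i\sim j$). The index-oriented edge set is $E'=\{(i,j): i<j,\ i\sim j\}$, and $w(e)=w_{ij}$ for $e=(i,j)\in E'$. $\mathbb{O}(d)$ is the group of $d\times d$ real orthogonal matrices, $d\ge1$. A connection is a map $\sigma:E'\to\mathbb{O}(d)$, written $\sigma_{ij}=\sigma((i,j))$, extended by $\sigma_{ji}=\sigma_{ij}^{-1}=\sigma_{ij}^\top$; the pair $(G,\sigma)$ is a connection graph. $\ell(V;\mathbb{R}^d)$ and $\ell(E';\mathbb{R}^d)$ are the spaces of functions $V\to\mathbb{R}^d$ and $E'\to\mathbb{R}^d$, identified with column vectors in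 $\mathbb{R}^{nd}$ and $\mathbb{R}^{md}$, with the standard inner product $\langle f,g\rangle=f^\top g$. The connection incidence matrix $B\in\mathbb{R}^{nd\times md}$ is the block matrix with $d\times d$ blocks, for $i\in V$, $e\in E'$: $B_{ie}=I_d$ if $e=(i,\cdot)$, $B_{ie}=-\sigma_e^\top$ if $e=(\cdot,i)$, and $B_{ie}=0$ otherwise; thus $(B^\top f)((i,j))=f(i)-\sigma_{ij}f(j)$. The infimum over the empty set is $+\infty$; the value $\mathcal{W}_1^\sigma(\alpha,\beta)$ is defined by the first infimum in the claim. *)

theory Defs
  imports "HOL-Analysis.Analysis"
begin

text \<open>
  The vertex set is \<open>{1..n}\<close>. Functions on vertices, functions on oriented edges and the weight are
  total functions on \<open>nat\<close>, \<open>nat \<times> nat\<close> and pairs of naturals; only their values on \<open>{1..n}\<close>, on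
  the oriented edge set and on \<open>{1..n} \<times> {1..n}\<close> are ever constrained or used. The dimension \<open>d \<ge> 1\<close> is
  \<open>CARD('d)\<close>.
\<close>

definition oriented_edges :: "nat set set \<Rightarrow> (nat \<times> nat) set" where
  "oriented_edges E = {(i, j). i < j \<and> {i, j} \<in> E}"

locale connected_weighted_graph =
  fixes n :: nat and E :: "nat set set" and w :: "nat \<Rightarrow> nat \<Rightarrow> real"
  assumes n_ge_2: "n \<ge> 2"
    and edges: "E \<subseteq> {e. e \<subseteq> {1..n} \<and> card e = 2}"
    and card_edges: "card E \<ge> 1"
    and weight_sym: "\<And>i j. i \<in> {1..n} \<Longrightarrow> j \<in> {1..n} \<Longrightarrow> w i j = w j i"
    and weight_nonneg: "\<And>i j. i \<in> {1..n} \<Longrightarrow> j \<in> {1..n} \<Longrightarrow> w i j \<ge> 0"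
    and weight_pos_iff: "\<And>i j. i \<in> {1..n} \<Longrightarrow> j \<in> {1..n} \<Longrightarrow> w i j > 0 \<longleftrightarrow> {i, j} \<in> E"
    and connected: "\<And>i j. i \<in> {1..n} \<Longrightarrow> j \<in> {1..n} \<Longrightarrow> (i, j) \<in> {(a, b). {a, b} \<in> E}\<^sup>*"

locale connection_graph = connected_weighted_graph n E w
  for n :: nat and E :: "nat set set" and w :: "nat \<Rightarrow> nat \<Rightarrow> real" +
  fixes \<sigma> :: "nat \<times> nat \<Rightarrow> real ^ 'd ^ 'd"
  assumes connection_orthogonal: "\<And>e. e \<in> oriented_edges E \<Longrightarrow> orthogonal_matrix (\<sigma> e)"

text \<open>The \<open>d \<times> d\<close> block of the connection incidence matrix in block row \<open>i\<close>, block column \<open>e\<close>.\<close>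

definition incidence_block ::
  "(nat \<times> nat \<Rightarrow> real ^ 'd ^ 'd) \<Rightarrow> nat \<Rightarrow> nat \<times> nat \<Rightarrow> real ^ 'd ^ 'd" where
  "incidence_block \<sigma> i e =
     (if i = fst e then mat 1 else if i = snd e then - transpose (\<sigma> e) else 0)"

text \<open>The block matrix-vector products \<open>B J\<close> and \<open>B\<^sup>T f\<close>.\<close>

definition incidence_mult ::
  "nat set set \<Rightarrow> (nat \<times> nat \<Rightarrow> real ^ 'd ^ 'd) \<Rightarrow> (nat \<times> nat \<Rightarrow> real ^ 'd) \<Rightarrow> nat \<Rightarrow> real ^ 'd" where
  "incidence_mult E \<sigma> J i = (\<Sum>e\<in>oriented_edges E. incidence_block \<sigma> i e *v J e)"

definition incidence_transpose_mult ::
  "nat \<Rightarrow> (nat \<times> nat \<Rightarrow> real ^ 'd ^ 'd) \<Rightarrow> (nat \<Rightarrow> real ^ 'd) \<Rightarrow> nat \<times> nat \<Rightarrow> real ^ 'd" where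
  "incidence_transpose_mult n \<sigma> f e = (\<Sum>i\<in>{1..n}. transpose (incidence_block \<sigma> i e) *v f i)"

lemma (in connection_graph) incidence_transpose_mult_edge:
  assumes "(i, j) \<in> oriented_edges E"
  shows "incidence_transpose_mult n \<sigma> f (i, j) = f i - \<sigma> (i, j) *v f j"
proof -
  have ij: "i < j" "i \<in> {1..n}" "j \<in> {1..n}"
    using assms edges by (auto simp: oriented_edges_def)
  have neg: "transpose (- transpose A) *v x = - (A *v x)" for A :: "real ^ 'd ^ 'd" and x
    by (simp add: vec_eq_iff matrix_vector_mult_def transpose_def sum_negf del: transpose_matrix_vector)
  have zero: "transpose (0 :: real ^ 'd ^ 'd) *v x = 0" for x
    by (simp add: vec_eq_iff matrix_vector_mult_def transpose_def del: transpose_matrix_vector)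
  have "incidence_transpose_mult n \<sigma> f (i, j) =
      (\<Sum>k\<in>{1..n}. (if k = i then f i else 0) + (if k = j then - (\<sigma> (i, j) *v f j) else 0))"
    unfolding incidence_transpose_mult_def incidence_block_def
    using ij by (intro sum.cong) (auto simp: neg zero transpose_mat simp del: transpose_matrix_vector)
  also have "\<dots> = f i - \<sigma> (i, j) *v f j"
    using ij by (simp add: sum.distrib)
  finally show ?thesis .
qed

text \<open>Extended real values: the infimum of the empty set is \<open>\<infinity>\<close>.\<close>

definition beckmann_W1 ::
  "nat \<Rightarrow> nat set set \<Rightarrow> (nat \<Rightarrow> nat \<Rightarrow> real) \<Rightarrow> (nat \<times> nat \<Rightarrow> real ^ 'd ^ 'd) \<Rightarrow>
    (nat \<Rightarrow> real ^ 'd) \<Rightarrow> (nat \<Rightarrow> real ^ 'd) \<Rightarrow> ereal" where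
  "beckmann_W1 n E w \<sigma> \<alpha> \<beta> =
     (INF J \<in> {J. \<forall>i\<in>{1..n}. incidence_mult E \<sigma> J i = \<alpha> i - \<beta> i}.
        ereal (\<Sum>(i, j)\<in>oriented_edges E. w i j * norm (J (i, j))))"

end

theory Submission
  imports Defs "HOL-Library.Function_Algebras"
begin

text \<open>
  Let \<open>M\<close> be the finite value of the supremum, so that \<open>\<langle>\<phi>, \<alpha> - \<beta>\<rangle> \<le> M s\<close> whenever
  \<open>\<parallel>(B\<^sup>T \<phi>)(e)\<parallel> \<le> s w(e)\<close> for all edges. On the range of \<open>B\<^sup>T\<close> the functional
  \<open>B\<^sup>T \<phi> \<mapsto> \<langle>\<phi>, \<alpha> - \<beta>\<rangle>\<close> is therefore bounded by \<open>M\<close> times the norm \<open>max\<^sub>e \<parallel>y(e)\<parallel> / w(e)\<close>, and by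
  the Hahn-Banach theorem it extends to all edge functions as \<open>y \<mapsto> \<langle>J, y\<rangle>\<close> with the same bound.
  Being an extension means \<open>B J = \<alpha> - \<beta>\<close>, and testing the bound on \<open>y(e) = w(e) J(e) / \<parallel>J(e)\<parallel>\<close>
  shows that \<open>J\<close> costs at most \<open>M\<close>. The reverse inequality is Cauchy-Schwarz on each edge.
\<close>

section \<open>Sublinear functionals\<close>

text \<open>The scalar multiplication is a parameter, so that functions can be scaled pointwise.
  Homogeneity is demanded only as an inequality, which is easier to verify;
  \<open>sublinear_scale\<close> recovers equality.\<close>

definition sublinear :: "(real \<Rightarrow> 'v \<Rightarrow> 'v) \<Rightarrow> ('v::ab_group_add \<Rightarrow> real) \<Rightarrow> bool" where
  "sublinear smul p \<longleftrightarrow>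
     (\<forall>x y. p (x + y) \<le> p x + p y) \<and> (\<forall>t x. 0 \<le> t \<longrightarrow> p (smul t x) \<le> t * p x)"

context
  fixes smul :: "real \<Rightarrow> 'v::ab_group_add \<Rightarrow> 'v"
  assumes vs: "vector_space smul"
begin

interpretation V: vector_space smul by (rule vs)

lemma sublinear_add: "sublinear smul p \<Longrightarrow> p (x + y) \<le> p x + p y"
  by (simp add: sublinear_def)

lemma sublinear_scale_le: "sublinear smul p \<Longrightarrow> 0 \<le> t \<Longrightarrow> p (smul t x) \<le> t * p x"
  by (simp add: sublinear_def)

lemma sublinear_zero:
  assumes "sublinear smul p" shows "p 0 = 0"
  using sublinear_add[OF assms, of 0 0] sublinear_scale_le[OF assms, of 0 0] by simp

lemma sublinear_neg:
  assumes "sublinear smul p" shows "- p x \<le> p (- x)"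
  using sublinear_add[OF assms, of x "- x"] sublinear_zero[OF assms] by simp

lemma sublinear_scale:
  assumes p: "sublinear smul p" and "0 \<le> t" shows "p (smul t x) = t * p x"
proof (cases "t = 0")
  case True
  then show ?thesis using sublinear_zero[OF p] by simp
next
  case False
  then have "0 < t" using assms by simp
  have "p x \<le> inverse t * p (smul t x)"
    using sublinear_scale_le[OF p, of "inverse t" "smul t x"] \<open>0 < t\<close> by simp
  then have "t * p x \<le> p (smul t x)"
    using \<open>0 < t\<close> by (simp add: field_simps)
  then show ?thesis using sublinear_scale_le[OF p \<open>0 \<le> t\<close>, of x] by simp
qed

text \<open>The one-dimensional step of Hahn-Banach, in the form that lowers a sublinear functional.\<close>

lemma sublinear_flatten:
  assumes p: "sublinear smul p"
  obtains q where "sublinear smul q" "\<And>x. q x \<le> p x" "q (- a) \<le> - q a"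
proof
  \<comment> \<open>Shift x along the ray in direction \<open>a\<close> and refund
    \<open>t * p a\<close>. The choice t = 0 keeps the infimum below \<open>p\<close>, and t = 1 at
    \<open>- a\<close> yields \<open>p 0 - p a\<close>; subadditivity keeps all values above
    \<open>- p (- x)\<close>.\<close>
  define D where "D x = (\<lambda>t. p (x + smul t a) - t * p a) ` {0..}" for x
  define q where "q x = Inf (D x)" for x
  have lower: "- p (- x) \<le> p (x + smul t a) - t * p a" if "0 \<le> t" for x t
  proof -
    have "t * p a = p (- x + (x + smul t a))"
      using sublinear_scale[OF p that, of a] by simp
    also have "\<dots> \<le> p (- x) + p (x + smul t a)" by (rule sublinear_add[OF p])
    finally show ?thesis by simp
  qed
  have bdd: "bdd_below (D x)" for x
    unfolding D_def using lower by (intro bdd_belowI2[where m = "- p (- x)"]) auto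
  have q_le: "q x \<le> p (x + smul t a) - t * p a" if "0 \<le> t" for x t
    unfolding q_def using that by (intro cInf_lower bdd) (auto simp: D_def)
  have q_ge: "m \<le> q x" if "\<And>t. 0 \<le> t \<Longrightarrow> m \<le> p (x + smul t a) - t * p a" for m x
    unfolding q_def using that by (intro cInf_greatest) (auto simp: D_def)
  show le: "q x \<le> p x" for x
    using q_le[of 0 x] by simp
  have "q (- a) \<le> - p a"
    using q_le[of 1 "- a"] sublinear_zero[OF p] by simp
  then show "q (- a) \<le> - q a"
    using le[of a] by simp
  have "q (x + y) \<le> q x + q y" for x y
  proof -
    have *: "q (x + y) \<le> (p (x + smul s a) - s * p a) + (p (y + smul t a) - t * p a)"
      if "0 \<le> s" "0 \<le> t" for s t
    proof -
      have "q (x + y) \<le> p ((x + smul s a) + (y + smul t a)) - (s + t) * p a"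
        using q_le[of "s + t" "x + y"] that by (simp add: V.scale_left_distrib algebra_simps)
      then show ?thesis
        using sublinear_add[OF p, of "x + smul s a" "y + smul t a"] by (simp add: algebra_simps)
    qed
    \<comment> \<open>The two infima are taken in turn: over the shift of y with s fixed, then over
      s.\<close>
    have "q (x + y) - (p (x + smul s a) - s * p a) \<le> q y" if "0 \<le> s" for s
      using *[OF that] by (intro q_ge) (simp add: algebra_simps)
    then have "q (x + y) - q y \<le> q x"
      by (intro q_ge) (simp add: algebra_simps)
    then show ?thesis by simp
  qed
  moreover have "q (smul t x) \<le> t * q x" if "0 \<le> t" for t x
  proof (cases "t = 0")
    case True
    then show ?thesis using le[of 0] sublinear_zero[OF p] by simp
  next
    case False
    then have "0 < t" using that by simp
    \<comment> \<open>Positive scaling reparametrizes the ray: the shift s for x becomes the shift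
      \<open>t * s\<close> for \<open>smul t x\<close>.\<close>
    have "q (smul t x) \<le> t * (p (x + smul s a) - s * p a)" if "0 \<le> s" for s
    proof -
      have "q (smul t x) \<le> p (smul t (x + smul s a)) - t * s * p a"
        using q_le[of "t * s" "smul t x"] that \<open>0 < t\<close> by (simp add: V.scale_right_distrib)
      then show ?thesis
        using sublinear_scale[OF p, of t "x + smul s a"] \<open>0 < t\<close> by (simp add: algebra_simps)
    qed
    then have "q (smul t x) / t \<le> q x"
      using \<open>0 < t\<close> by (intro q_ge) (simp add: divide_le_eq mult.commute)
    then show ?thesis using \<open>0 < t\<close> by (simp add: divide_le_eq mult.commute)
  qed
  ultimately show "sublinear smul q" by (simp add: sublinear_def)
qed

text \<open>Vectors are flattened one at a time. Flatness of b under q survives a further lowering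
  to r, since r(-b) \<le> q(-b) \<le> -q(b) \<le> -r(b).\<close>

lemma sublinear_flatten_finite:
  assumes "finite S" and p: "sublinear smul p"
  obtains q where "sublinear smul q" "\<And>x. q x \<le> p x" "\<And>a. a \<in> S \<Longrightarrow> q (- a) \<le> - q a"
  using assms(1)
proof (induction S arbitrary: thesis rule: finite_induct)
  case empty
  then show ?case using p by blast
next
  case (insert a S)
  obtain q where q: "sublinear smul q" "\<And>x. q x \<le> p x" "\<And>b. b \<in> S \<Longrightarrow> q (- b) \<le> - q b"
    using insert.IH by blast
  obtain r where r: "sublinear smul r" "\<And>x. r x \<le> q x" "r (- a) \<le> - r a"
    using sublinear_flatten[OF q(1)] by blast
  show ?case
  proof (rule insert.prems)
    show "r x \<le> p x" for x using r(2)[of x] q(2)[of x] by simp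
    show "r (- b) \<le> - r b" if "b \<in> insert a S" for b
    proof (cases "b = a")
      case False
      then show ?thesis using that r(2)[of b] r(2)[of "- b"] q(3)[of b] by simp
    qed (use r(3) in simp)
  qed (fact r(1))
qed

text \<open>Together with \<open>sublinear_neg\<close>, flatness means
  \<open>q (- a) = - q a\<close>, which extends homogeneity to negative scalars.\<close>

lemma sublinear_scale_flat:
  assumes q: "sublinear smul q" and a: "q (- a) \<le> - q a"
  shows "q (smul t a) = t * q a"
proof (cases "0 \<le> t")
  case True
  then show ?thesis by (rule sublinear_scale[OF q])
next
  case False
  have "q (- a) = - q a" using a sublinear_neg[OF q, of a] by simp
  then show ?thesis
    using sublinear_scale[OF q, of "- t" "- a"] False by simp
qed

text \<open>Subadditivity gives one inequality for arbitrary coefficients; applied to the negated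
  coefficients it gives the other. So q is linear on the span of flat vectors.\<close>

lemma sublinear_sum_flat:
  assumes q: "sublinear smul q" and "finite S" and flat: "\<And>a. a \<in> S \<Longrightarrow> q (- v a) \<le> - q (v a)"
  shows "q (\<Sum>a\<in>S. smul (c a) (v a)) = (\<Sum>a\<in>S. c a * q (v a))"
proof -
  have upper: "q (\<Sum>a\<in>S. smul (c a) (v a)) \<le> (\<Sum>a\<in>S. c a * q (v a))" for c
    using \<open>finite S\<close> flat
  proof (induction S rule: finite_induct)
    case empty
    then show ?case using sublinear_zero[OF q] by simp
  next
    case (insert a S)
    have "q (\<Sum>a\<in>insert a S. smul (c a) (v a))
        \<le> q (smul (c a) (v a)) + q (\<Sum>a\<in>S. smul (c a) (v a))"
      using insert.hyps sublinear_add[OF q] by simp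
    then show ?case
      using insert sublinear_scale_flat[OF q, of "v a" "c a"] by fastforce
  qed
  have "- q (\<Sum>a\<in>S. smul (c a) (v a)) \<le> q (\<Sum>a\<in>S. smul (- c a) (v a))"
    using sublinear_neg[OF q, of "\<Sum>a\<in>S. smul (c a) (v a)"] by (simp add: sum_negf)
  also have "\<dots> \<le> - (\<Sum>a\<in>S. c a * q (v a))"
    using upper[of "\<lambda>a. - c a"] by (simp add: sum_negf)
  finally show ?thesis using upper[of c] by simp
qed

end

section \<open>Functionals bounded on a finite product\<close>

definition pointwise_scale :: "real \<Rightarrow> ('i \<Rightarrow> 'a::real_vector) \<Rightarrow> 'i \<Rightarrow> 'a" where
  "pointwise_scale r f = (\<lambda>x. r *\<^sub>R f x)"

lemma pointwise_scale_apply [simp]: "pointwise_scale r f x = r *\<^sub>R f x"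
  by (simp add: pointwise_scale_def)

lemma vector_space_pointwise_scale: "vector_space pointwise_scale"
  by unfold_locales (auto simp: fun_eq_iff scaleR_add_left scaleR_add_right)

lemma sum_apply: "(\<Sum>a\<in>S. f a) x = (\<Sum>a\<in>S. f a x)"
  by (induction S rule: infinite_finite_induct) auto

text \<open>Hahn-Banach combined with Riesz representation: flattening along the finitely many
  coordinate directions over \<open>F\<close> already makes the dominating functional linear on
  functions supported in \<open>F\<close>, and its coordinates form \<open>J\<close>.\<close>

lemma bounded_functional_representation:
  fixes T :: "('i \<Rightarrow> 'a::real_vector) \<Rightarrow> 'e \<Rightarrow> 'v::euclidean_space"
    and l :: "('i \<Rightarrow> 'a) \<Rightarrow> real"
  assumes "finite F" and w: "\<And>e. e \<in> F \<Longrightarrow> 0 < w e"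
    and T: "Vector_Spaces.linear pointwise_scale pointwise_scale T"
    and l: "Vector_Spaces.linear pointwise_scale (*) l"
    and bound: "\<And>\<phi>. (\<And>e. e \<in> F \<Longrightarrow> norm (T \<phi> e) \<le> w e) \<Longrightarrow> l \<phi> \<le> M"
  obtains J where "\<And>\<phi>. (\<Sum>e\<in>F. J e \<bullet> T \<phi> e) = l \<phi>" "(\<Sum>e\<in>F. w e * norm (J e)) \<le> M"
proof -
  interpret T: Vector_Spaces.linear pointwise_scale pointwise_scale T by (rule T)
  interpret l: Vector_Spaces.linear pointwise_scale "(*)" l by (rule l)
  have vs: "vector_space (pointwise_scale :: real \<Rightarrow> ('e \<Rightarrow> 'v) \<Rightarrow> _)"
    by (rule vector_space_pointwise_scale)
  have "0 \<le> M"
    using bound[of 0] w by (simp add: T.zero l.zero less_imp_le)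
  have scaled_bound: "l \<phi> \<le> M * s" if "0 \<le> s" and \<phi>: "\<And>e. e \<in> F \<Longrightarrow> norm (T \<phi> e) \<le> s * w e" for \<phi> s
  proof (cases "s = 0")
    case True
    \<comment> \<open>Here \<open>T \<phi>\<close> vanishes on \<open>F\<close>, so every multiple
      of \<phi> is admissible. If \<open>l \<phi>\<close> were positive, the multiple with value M +
      1 would violate the bound.\<close>
    have "t * l \<phi> \<le> M" for t
      using bound[of "pointwise_scale t \<phi>"] \<phi> True w
      by (simp add: T.scale l.scale less_imp_le)
    from this[of "(M + 1) / l \<phi>"] show ?thesis
      using True by (cases "l \<phi> \<le> 0") auto
  next
    case False
    then have "0 < s" using that by simp
    then have "inverse s * l \<phi> \<le> M"
      using bound[of "pointwise_scale (inverse s) \<phi>"] \<phi>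
      by (simp add: T.scale l.scale field_simps)
    then show ?thesis using \<open>0 < s\<close> by (simp add: field_simps)
  qed
  text \<open>\<open>p\<close> is the largest sublinear functional below \<open>M * max\<^sub>e (norm (y e) / w e)\<close> whose value at
    each \<open>T \<phi>\<close> is at most \<open>l \<phi>\<close>; a linear functional below \<open>p\<close> is the required extension of \<open>l\<close>.\<close>
  define A where "A y = {(s, \<phi>). 0 \<le> s \<and> (\<forall>e\<in>F. norm (y e - T \<phi> e) \<le> s * w e)}" for y
  define p where "p y = (INF (s, \<phi>)\<in>A y. M * s + l \<phi>)" for y
  have norm_le: "\<exists>r\<ge>0. \<forall>e\<in>F. norm (y e) \<le> r * w e" for y :: "'e \<Rightarrow> 'v"
  proof (intro exI conjI ballI)
    \<comment> \<open>A sum in place of the maximum, so that an empty \<open>F\<close> needs no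
      separate case.\<close>
    let ?r = "\<Sum>e\<in>F. norm (y e) / w e"
    show "0 \<le> ?r" using w by (intro sum_nonneg) (simp add: less_imp_le)
    fix e assume "e \<in> F"
    then have "norm (y e) / w e \<le> ?r"
      using \<open>finite F\<close> w by (intro member_le_sum) (auto simp: less_imp_le)
    then show "norm (y e) \<le> ?r * w e" using w[OF \<open>e \<in> F\<close>] by (simp add: field_simps)
  qed
  have nonempty: "A y \<noteq> {}" for y
  proof -
    obtain r where "0 \<le> r" "\<forall>e\<in>F. norm (y e) \<le> r * w e" using norm_le by blast
    then have "(r, 0) \<in> A y" by (simp add: A_def T.zero)
    then show ?thesis by blast
  qed
  have bdd: "bdd_below ((\<lambda>(s, \<phi>). M * s + l \<phi>) ` A y)" for y
  proof -
    obtain r where r: "0 \<le> r" "\<forall>e\<in>F. norm (y e) \<le> r * w e" using norm_le by blast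
    \<comment> \<open>By the triangle inequality \<open>- \<phi>\<close> is admissible at scale
      \<open>s + r\<close>, so \<open>scaled_bound\<close> controls
      \<open>- l \<phi>\<close>.\<close>
    have "- (M * r) \<le> M * s + l \<phi>" if "(s, \<phi>) \<in> A y" for s \<phi>
    proof -
      have s: "0 \<le> s" "\<forall>e\<in>F. norm (y e - T \<phi> e) \<le> s * w e" using that by (auto simp: A_def)
      have "norm (T (- \<phi>) e) \<le> (s + r) * w e" if "e \<in> F" for e
      proof -
        have "norm (T (- \<phi>) e) \<le> norm (y e - T \<phi> e) + norm (y e)"
          using norm_triangle_ineq4[of "y e - T \<phi> e" "y e"] by (simp add: T.neg)
        then show ?thesis using s(2) r(2) that by (fastforce simp: algebra_simps)
      qed
      then show ?thesis
        using scaled_bound[of "s + r" "- \<phi>"] s(1) r(1) by (simp add: l.neg algebra_simps)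
    qed
    then show ?thesis by (intro bdd_belowI2[where m = "- (M * r)"]) auto
  qed
  have p_le: "p y \<le> M * s + l \<phi>" if "(s, \<phi>) \<in> A y" for y s \<phi>
    unfolding p_def using cINF_lower[OF bdd that] by simp
  have p_ge: "m \<le> p y" if "\<And>s \<phi>. (s, \<phi>) \<in> A y \<Longrightarrow> m \<le> M * s + l \<phi>" for m y
    unfolding p_def using that by (intro cINF_greatest nonempty) auto
  have "p (x + y) \<le> p x + p y" for x y
  proof -
    have *: "p (x + y) \<le> (M * s + l \<phi>) + (M * t + l \<psi>)" if "(s, \<phi>) \<in> A x" "(t, \<psi>) \<in> A y" for s t \<phi> \<psi>
    proof -
      have "norm ((x + y) e - T (\<phi> + \<psi>) e) \<le> (s + t) * w e" if "e \<in> F" for e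
      proof -
        have "norm ((x + y) e - T (\<phi> + \<psi>) e) \<le> norm (x e - T \<phi> e) + norm (y e - T \<psi> e)"
          using norm_triangle_ineq[of "x e - T \<phi> e" "y e - T \<psi> e"]
          by (simp add: T.add algebra_simps)
        moreover have "norm (x e - T \<phi> e) \<le> s * w e" "norm (y e - T \<psi> e) \<le> t * w e"
          using \<open>(s, \<phi>) \<in> A x\<close> \<open>(t, \<psi>) \<in> A y\<close> \<open>e \<in> F\<close> by (auto simp: A_def)
        ultimately show ?thesis by (simp add: algebra_simps)
      qed
      then have "(s + t, \<phi> + \<psi>) \<in> A (x + y)"
        using that by (auto simp: A_def)
      from p_le[OF this] show ?thesis by (simp add: l.add algebra_simps)
    qed
    have "p (x + y) - (M * s + l \<phi>) \<le> p y" if "(s, \<phi>) \<in> A x" for s \<phi>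
      using *[OF that] by (intro p_ge) (simp add: algebra_simps)
    then have "p (x + y) - p y \<le> p x"
      by (intro p_ge) (simp add: algebra_simps)
    then show ?thesis by simp
  qed
  moreover have "p (pointwise_scale t y) \<le> t * p y" if "0 \<le> t" for t y
  proof (cases "t = 0")
    case True
    have "(0, 0) \<in> A (pointwise_scale 0 y)" by (simp add: A_def T.zero)
    from p_le[OF this] True show ?thesis by (simp add: l.zero)
  next
    case False
    then have "0 < t" using that by simp
    have "p (pointwise_scale t y) \<le> t * (M * s + l \<phi>)" if "(s, \<phi>) \<in> A y" for s \<phi>
    proof -
      have "(t * s, pointwise_scale t \<phi>) \<in> A (pointwise_scale t y)"
        using that \<open>0 < t\<close>
        by (auto simp: A_def T.scale mult.assoc simp flip: scaleR_diff_right)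
      from p_le[OF this] show ?thesis by (simp add: l.scale algebra_simps)
    qed
    then have "p (pointwise_scale t y) / t \<le> p y"
      using \<open>0 < t\<close> by (intro p_ge) (simp add: divide_le_eq mult.commute)
    then show ?thesis using \<open>0 < t\<close> by (simp add: divide_le_eq mult.commute)
  qed
  ultimately have p: "sublinear pointwise_scale p"
    by (simp add: sublinear_def)
  define \<delta> :: "'e \<times> 'v \<Rightarrow> 'e \<Rightarrow> 'v" where "\<delta> = (\<lambda>(e, b) e'. if e' = e then b else 0)"
  let ?I = "F \<times> (Basis :: 'v set)"
  have "finite (\<delta> ` ?I)" using \<open>finite F\<close> by simp
  then obtain q where q: "sublinear pointwise_scale q" "\<And>y. q y \<le> p y"
      "\<And>a. a \<in> \<delta> ` ?I \<Longrightarrow> q (- a) \<le> - q a"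
    using sublinear_flatten_finite[OF vs _ p] by blast
  define J where "J e = (\<Sum>b\<in>Basis. q (\<delta> (e, b)) *\<^sub>R b)" for e
  have J_inner: "J e \<bullet> v = (\<Sum>b\<in>Basis. (v \<bullet> b) * q (\<delta> (e, b)))" for e v
    unfolding J_def inner_sum_left by (simp add: inner_commute mult.commute)
  \<comment> \<open>The functions \<open>\<delta> (e, b)\<close> span only functions vanishing off
    \<open>F\<close>, hence the cutoff; membership in \<open>A\<close> ignores values off
    \<open>F\<close>.\<close>
  have q_eq: "(\<Sum>e\<in>F. J e \<bullet> y e) = q (\<lambda>e. if e \<in> F then y e else 0)" for y
  proof -
    have "(\<lambda>e. if e \<in> F then y e else 0) =
        (\<Sum>a\<in>?I. pointwise_scale (y (fst a) \<bullet> snd a) (\<delta> a))" (is "?l = ?r")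
    proof
      fix e
      have "?r e = (\<Sum>e'\<in>F. \<Sum>b\<in>Basis. if e = e' then (y e' \<bullet> b) *\<^sub>R b else 0)"
        by (simp add: sum_apply \<delta>_def sum.cartesian_product if_distrib cong: if_cong)
           (rule sum.cong, auto)
      also have "\<dots> = (\<Sum>e'\<in>F. if e = e' then y e' else 0)"
        by (rule sum.cong) (auto simp: euclidean_representation)
      also have "\<dots> = ?l e" using \<open>finite F\<close> by simp
      finally show "?l e = ?r e" by simp
    qed
    moreover have "q ?r = (\<Sum>a\<in>?I. (y (fst a) \<bullet> snd a) * q (\<delta> a))"
      using \<open>finite F\<close> q(3) by (intro sublinear_sum_flat[OF vs q(1)]) auto
    moreover have "\<dots> = (\<Sum>e\<in>F. J e \<bullet> y e)"
      by (simp add: J_inner sum.cartesian_product split_def)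
    ultimately show ?thesis by simp
  qed
  \<comment> \<open>Two instances matter: s = 0 with \<open>y = T \<phi>\<close> gives the extension
    property, and \<phi> = 0 with s = 1 gives the norm bound.\<close>
  have le: "(\<Sum>e\<in>F. J e \<bullet> y e) \<le> M * s + l \<phi>"
    if "0 \<le> s" "\<And>e. e \<in> F \<Longrightarrow> norm (y e - T \<phi> e) \<le> s * w e" for y s \<phi>
    unfolding q_eq using that by (intro order_trans[OF q(2) p_le]) (auto simp: A_def)
  have T_le: "(\<Sum>e\<in>F. J e \<bullet> T \<phi> e) \<le> l \<phi>" for \<phi>
    using le[of 0 "T \<phi>" \<phi>] by simp
  show thesis
  proof
    show "(\<Sum>e\<in>F. J e \<bullet> T \<phi> e) = l \<phi>" for \<phi>
      using T_le[of \<phi>] T_le[of "- \<phi>"] by (simp add: T.neg l.neg sum_negf)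
    have "v \<bullet> sgn v = norm v" for v :: 'v
      by (cases "v = 0") (simp_all add: sgn_div_norm dot_square_norm power2_eq_square)
    \<comment> \<open>The extremal test function; \<open>sgn\<close> is 0 where J vanishes, so its
      norm never exceeds \<open>w e\<close>.\<close>
    then have "(\<Sum>e\<in>F. w e * norm (J e)) = (\<Sum>e\<in>F. J e \<bullet> (w e *\<^sub>R sgn (J e)))"
      by simp
    also have "\<dots> \<le> M * 1 + l 0"
      using w by (intro le) (auto simp: T.zero norm_sgn less_imp_le)
    finally show "(\<Sum>e\<in>F. w e * norm (J e)) \<le> M" by (simp add: l.zero)
  qed
qed

section \<open>The Beckmann problem\<close>

lemma incidence_adjoint:
  "(\<Sum>i\<in>{1..n}. \<phi> i \<bullet> incidence_mult E \<sigma> J i) =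
   (\<Sum>e\<in>oriented_edges E. incidence_transpose_mult n \<sigma> \<phi> e \<bullet> J e)"
  unfolding incidence_mult_def incidence_transpose_mult_def inner_sum_right inner_sum_left
  by (subst sum.swap) (simp add: dot_lmul_matrix)

lemma linear_incidence_transpose_mult:
  fixes \<sigma> :: "nat \<times> nat \<Rightarrow> real ^ 'd ^ 'd"
  shows "Vector_Spaces.linear pointwise_scale pointwise_scale (incidence_transpose_mult n \<sigma>)"
  by (simp add: Vector_Spaces.linear_iff vector_space_pointwise_scale fun_eq_iff
      incidence_transpose_mult_def vector_matrix_left_distrib sum.distrib scaleR_sum_right
      scaleR_vector_matrix_assoc)

lemma linear_inner_sum:
  fixes c :: "'i \<Rightarrow> 'a::real_inner"
  shows "Vector_Spaces.linear pointwise_scale (*) (\<lambda>\<phi>. \<Sum>i\<in>S. \<phi> i \<bullet> c i)"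
proof -
  have "vector_space ((*) :: real \<Rightarrow> real \<Rightarrow> real)"
    by unfold_locales (simp_all add: algebra_simps)
  then show ?thesis
    by (simp add: Vector_Spaces.linear_iff vector_space_pointwise_scale inner_add_left
        sum.distrib sum_distrib_left)
qed

context connection_graph
begin

lemma finite_oriented_edges: "finite (oriented_edges E)"
  by (rule finite_subset[of _ "{1..n} \<times> {1..n}"]) (use edges in \<open>auto simp: oriented_edges_def\<close>)

lemma weight_pos: "(i, j) \<in> oriented_edges E \<Longrightarrow> 0 < w i j"
  using edges weight_pos_iff[of i j] by (auto simp: oriented_edges_def)

lemma beckmann_weak_duality:
  assumes J: "\<forall>i\<in>{1..n}. incidence_mult E \<sigma> J i = c i"
    and \<phi>: "\<forall>(i, j)\<in>oriented_edges E. norm (incidence_transpose_mult n \<sigma> \<phi> (i, j)) \<le> w i j"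
  shows "(\<Sum>i\<in>{1..n}. \<phi> i \<bullet> c i) \<le> (\<Sum>(i, j)\<in>oriented_edges E. w i j * norm (J (i, j)))"
proof -
  have "(\<Sum>i\<in>{1..n}. \<phi> i \<bullet> c i) =
      (\<Sum>e\<in>oriented_edges E. incidence_transpose_mult n \<sigma> \<phi> e \<bullet> J e)"
    using J by (simp flip: incidence_adjoint)
  also have "\<dots> \<le> (\<Sum>(i, j)\<in>oriented_edges E. w i j * norm (J (i, j)))"
  proof (rule sum_mono, clarify)
    fix i j assume "(i, j) \<in> oriented_edges E"
    then have "norm (incidence_transpose_mult n \<sigma> \<phi> (i, j)) \<le> w i j" using \<phi> by blast
    then show "incidence_transpose_mult n \<sigma> \<phi> (i, j) \<bullet> J (i, j) \<le> w i j * norm (J (i, j))"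
      by (intro order_trans[OF norm_cauchy_schwarz] mult_right_mono) auto
  qed
  finally show ?thesis .
qed

text \<open>A finite dual bound yields both feasibility and a flow of cost at most that bound, by
  taking B transposed for \<open>T\<close> and the pairing with \<open>c\<close> for
  \<open>l\<close>.\<close>

lemma beckmann_flow_exists:
  assumes bound: "\<And>\<phi>. \<forall>(i, j)\<in>oriented_edges E.
      norm (incidence_transpose_mult n \<sigma> \<phi> (i, j)) \<le> w i j \<Longrightarrow> (\<Sum>i\<in>{1..n}. \<phi> i \<bullet> c i) \<le> M"
  obtains J where "\<forall>i\<in>{1..n}. incidence_mult E \<sigma> J i = c i"
    "(\<Sum>(i, j)\<in>oriented_edges E. w i j * norm (J (i, j))) \<le> M"
proof -
  obtain J where J: "\<And>\<phi>. (\<Sum>e\<in>oriented_edges E. J e \<bullet> incidence_transpose_mult n \<sigma> \<phi> e) =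
        (\<Sum>i\<in>{1..n}. \<phi> i \<bullet> c i)"
      "(\<Sum>e\<in>oriented_edges E. (case e of (i, j) \<Rightarrow> w i j) * norm (J e)) \<le> M"
  proof (rule bounded_functional_representation[OF finite_oriented_edges _
        linear_incidence_transpose_mult[of n \<sigma>] linear_inner_sum[where S = "{1..n}" and c = c]])
    show "0 < (case e of (i, j) \<Rightarrow> w i j)" if "e \<in> oriented_edges E" for e
      using that weight_pos by (cases e) auto
    show "(\<Sum>i\<in>{1..n}. \<phi> i \<bullet> c i) \<le> M"
      if "\<And>e. e \<in> oriented_edges E \<Longrightarrow>
            norm (incidence_transpose_mult n \<sigma> \<phi> e) \<le> (case e of (i, j) \<Rightarrow> w i j)" for \<phi>
      using that by (intro bound) force
  qed (rule that)
  show thesis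
  proof
    show "\<forall>i\<in>{1..n}. incidence_mult E \<sigma> J i = c i"
    proof
      fix i assume i: "i \<in> {1..n}"
      have single: "(\<Sum>k\<in>{1..n}. (if k = i then v else 0) \<bullet> f k) = v \<bullet> f i"
        for v :: "real ^ 'd" and f
        using i by (simp add: if_distrib[of "\<lambda>x. x \<bullet> _"] cong: if_cong)
      have "v \<bullet> incidence_mult E \<sigma> J i = v \<bullet> c i" for v
      proof -
        \<comment> \<open>Potentials concentrated at one vertex isolate the constraint
          there.\<close>
        let ?\<phi> = "\<lambda>k. if k = i then v else 0"
        have "v \<bullet> incidence_mult E \<sigma> J i = (\<Sum>k\<in>{1..n}. ?\<phi> k \<bullet> incidence_mult E \<sigma> J k)"
          by (simp only: single)
        also have "\<dots> = (\<Sum>e\<in>oriented_edges E. J e \<bullet> incidence_transpose_mult n \<sigma> ?\<phi> e)"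
          unfolding incidence_adjoint by (simp only: inner_commute)
        also have "\<dots> = (\<Sum>k\<in>{1..n}. ?\<phi> k \<bullet> c k)" by (rule J(1))
        also have "\<dots> = v \<bullet> c i" by (simp only: single)
        finally show ?thesis .
      qed
      then show "incidence_mult E \<sigma> J i = c i"
        using vector_eq_ldot by blast
    qed
    show "(\<Sum>(i, j)\<in>oriented_edges E. w i j * norm (J (i, j))) \<le> M"
      using J(2) by (simp add: split_def)
  qed
qed

end

theorem theorem3p1:
  fixes n :: nat and E :: "nat set set" and w :: "nat \<Rightarrow> nat \<Rightarrow> real"
    and \<sigma> :: "nat \<times> nat \<Rightarrow> real ^ 'd ^ 'd" and \<alpha> \<beta> :: "nat \<Rightarrow> real ^ 'd"
  assumes "connection_graph n E w \<sigma>"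
  shows "beckmann_W1 n E w \<sigma> \<alpha> \<beta> =
           (INF J \<in> {J. \<forall>i\<in>{1..n}. incidence_mult E \<sigma> J i = \<alpha> i - \<beta> i}.
              ereal (\<Sum>(i, j)\<in>oriented_edges E. w i j * norm (J (i, j))))
       \<and> (INF J \<in> {J. \<forall>i\<in>{1..n}. incidence_mult E \<sigma> J i = \<alpha> i - \<beta> i}.
              ereal (\<Sum>(i, j)\<in>oriented_edges E. w i j * norm (J (i, j)))) =
           (SUP \<phi> \<in> {\<phi>. \<forall>(i, j)\<in>oriented_edges E.
                            norm (incidence_transpose_mult n \<sigma> \<phi> (i, j)) \<le> w i j}.
              ereal (\<Sum>i\<in>{1..n}. \<phi> i \<bullet> (\<alpha> i - \<beta> i)))
       \<and> 0 \<le> beckmann_W1 n E w \<sigma> \<alpha> \<beta>"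
proof -
  interpret connection_graph n E w \<sigma> by (rule assms)
  let ?P = "{J. \<forall>i\<in>{1..n}. incidence_mult E \<sigma> J i = \<alpha> i - \<beta> i}"
  let ?D = "{\<phi>. \<forall>(i, j)\<in>oriented_edges E.
      norm (incidence_transpose_mult n \<sigma> \<phi> (i, j)) \<le> w i j}"
  let ?cost = "\<lambda>J. \<Sum>(i, j)\<in>oriented_edges E. w i j * norm (J (i, j))"
  let ?val = "\<lambda>\<phi>. \<Sum>i\<in>{1..n}. \<phi> i \<bullet> (\<alpha> i - \<beta> i)"
  \<comment> \<open>Feasibility of the zero potential excludes the value -\<infinity> and gives
    nonnegativity.\<close>
  have zero: "(\<lambda>_. 0) \<in> ?D"
    by (auto simp: incidence_transpose_mult_def weight_pos less_imp_le)
  have SUP_nonneg: "0 \<le> (SUP \<phi>\<in>?D. ereal (?val \<phi>))"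
    using SUP_upper[OF zero, of "\<lambda>\<phi>. ereal (?val \<phi>)"] by (simp add: zero_ereal_def)
  have weak: "(SUP \<phi>\<in>?D. ereal (?val \<phi>)) \<le> (INF J\<in>?P. ereal (?cost J))"
  proof (intro SUP_least INF_greatest)
    fix \<phi> J assume "\<phi> \<in> ?D" "J \<in> ?P"
    then show "ereal (?val \<phi>) \<le> ereal (?cost J)"
      using beckmann_weak_duality[of J "\<lambda>i. \<alpha> i - \<beta> i" \<phi>] by simp
  qed
  have strong: "(INF J\<in>?P. ereal (?cost J)) \<le> (SUP \<phi>\<in>?D. ereal (?val \<phi>))"
  \<comment> \<open>A supremum of +\<infinity> makes the inequality trivial; this includes the case
    of no feasible flow, by the contrapositive of \<open>beckmann_flow_exists\<close>.\<close>
  proof (cases "SUP \<phi>\<in>?D. ereal (?val \<phi>)")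
    case (real M)
    have "?val \<phi> \<le> M" if "\<phi> \<in> ?D" for \<phi>
      using SUP_upper[OF that, of "\<lambda>\<phi>. ereal (?val \<phi>)"] unfolding real by simp
    then obtain J where J: "\<forall>i\<in>{1..n}. incidence_mult E \<sigma> J i = \<alpha> i - \<beta> i" "?cost J \<le> M"
      using beckmann_flow_exists[of "\<lambda>i. \<alpha> i - \<beta> i" M] by auto
    have "(INF J\<in>?P. ereal (?cost J)) \<le> ereal (?cost J)"
      using J(1) by (intro INF_lower) simp
    also have "\<dots> \<le> ereal M" using J(2) by simp
    finally show ?thesis unfolding real .
  next
    case MInf
    then show ?thesis using SUP_nonneg by simp
  qed simp
  show ?thesis
    unfolding beckmann_W1_def
    using order_antisym[OF strong weak] order_trans[OF SUP_nonneg weak] by blast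
qed

end
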